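(* Let $(\Omega,\mathcal{F},\mathbb{P})$ be a complete probability space with filtration $\{\mathcal{F}_t\}_{t\ge0}$, let $w_1,\dots,w_N$ be independent standard one-dimensional Brownian motions with $(w_1,\dots,w_N)$ $\mathcal{F}_t$-adapted, and let $\Delta_1,\dots,\Delta_N\in\mathbb{R}^{n\times n}$ be constant matrices. Define $\bar A(t)=A+\frac1t\sum_{i=1}^N\Delta_iw_i(t)$ for $t>0$ (the time average of the noisy estimate $\hat A=A+\sum_i\Delta_i\dot w_i$ of $A$), and let $P$ solve $$\dot P=\bar A(t)^TP+P\bar A(t)-PBR^{-1}B^TP+Q,\qquad P(0)\in\mathcal{S}^n_+.$$ Then $\lim_{t\to\infty}P(t)=P^*$ with probability one.
   Context: $A\in\mathbb{R}^{n\times n}$, $B\in\mathbb{R}^{n\times m}$ with $(A,B)$ stabilizable; $Q=Q^T\ge0$ (taken $>0$ in this setting), $R=R^T>0$, $(A,Q^{1/2})$ observable. $P^*$ is the unique symmetric positive definite solution of $0=A^TP+PA-PBR^{-1}B^TP+Q$. $\mathcal{S}^n_+$ is the set of real symmetric positive definite $n\times n$ matrices. *)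

theory Defs
  imports "HOL-Probability.Probability"
begin

definition sym_posdef :: "real^'n^'n \<Rightarrow> bool" where
  "sym_posdef M \<longleftrightarrow> transpose M = M \<and> (\<forall>x. x \<noteq> 0 \<longrightarrow> x \<bullet> (M *v x) > 0)"

definition hurwitz :: "real^'n^'n \<Rightarrow> bool" where
  "hurwitz M \<longleftrightarrow> (\<forall>(l::complex) (v::complex^'n). v \<noteq> 0 \<and>
      (\<chi> i j. complex_of_real (M $ i $ j)) *v v = l *s v \<longrightarrow> Re l < 0)"

definition stabilizable :: "real^'n^'n \<Rightarrow> real^'m^'n \<Rightarrow> bool" where
  "stabilizable A B \<longleftrightarrow> (\<exists>K :: real^'n^'m. hurwitz (A - B ** K))"

definition standard_BM :: "'a measure \<Rightarrow> (real \<Rightarrow> 'a \<Rightarrow> real) \<Rightarrow> bool" where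
  "standard_BM M W \<longleftrightarrow>
     (\<forall>t\<ge>0. W t \<in> borel_measurable M) \<and>
     (AE \<omega> in M. W 0 \<omega> = 0) \<and>
     (AE \<omega> in M. continuous_on {0..} (\<lambda>t. W t \<omega>)) \<and>
     (\<forall>s t. 0 \<le> s \<and> s < t \<longrightarrow>
        distributed M lborel (\<lambda>\<omega>. W t \<omega> - W s \<omega>) (normal_density 0 (sqrt (t - s)))) \<and>
     (\<forall>(ts::nat \<Rightarrow> real) k. 0 \<le> ts 0 \<and> (\<forall>j<k. ts j < ts (Suc j)) \<longrightarrow>
        prob_space.indep_vars M (\<lambda>_. borel) (\<lambda>j \<omega>. W (ts (Suc j)) \<omega> - W (ts j) \<omega>) {..<k})"

definition filtration_of :: "'a measure \<Rightarrow> (real \<Rightarrow> 'a measure) \<Rightarrow> bool" where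
  "filtration_of M F \<longleftrightarrow> filtration (space M) F \<and> (\<forall>t. sets (F t) \<subseteq> sets M)"

definition Abar :: "real^'n^'n \<Rightarrow> ('k::finite \<Rightarrow> real^'n^'n) \<Rightarrow> ('k \<Rightarrow> real \<Rightarrow> 'a \<Rightarrow> real)
     \<Rightarrow> real \<Rightarrow> 'a \<Rightarrow> real^'n^'n" where
  "Abar A D w t \<omega> = A + (1 / t) *\<^sub>R (\<Sum>i\<in>UNIV. w i t \<omega> *\<^sub>R D i)"

definition riccati_rhs :: "real^'n^'n \<Rightarrow> real^'m^'n \<Rightarrow> real^'n^'n \<Rightarrow> real^'m^'m
     \<Rightarrow> real^'n^'n \<Rightarrow> real^'n^'n" where
  "riccati_rhs A B Q R P = transpose A ** P + P ** A - P ** B ** matrix_inv R ** transpose B ** P + Q"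

end

theory Submission
  imports Defs
begin

text \<open>
  Write \<open>E(t)\<close> for the noise \<open>(1/t) \<Sum> \<Delta>\<^sub>i w\<^sub>i(t)\<close>. Fourth moments of the increments and dyadic chaining
  on the intervals \<open>[0, 16^m]\<close> and \<open>[0, 16^(-m)]\<close> give \<open>|w\<^sub>i(t)| \<le> C (t^(1/4) + t^(3/4))\<close> for all
  \<open>t > 0\<close>, almost surely. Hence \<open>E(t)\<close> is integrable at \<open>0\<close>, so that \<open>P\<close> stays symmetric by Gronwall's
  inequality, and \<open>E(t) \<rightarrow> 0\<close> at infinity.

  Convergence comes from comparing \<open>P\<close> with multiples of \<open>P*\<close>. If \<open>m P* - P\<close> is positive
  semidefinite with kernel vector \<open>x\<close>, then the equation for \<open>P*\<close> gives
  \<open>x\<^sup>T P' x = (1 - m) (m s + x\<^sup>T Q x) + 2 m x\<^sup>T P* E x\<close> with \<open>s \<ge> 0\<close>. Since \<open>Q\<close> dominates a positive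
  multiple of \<open>P*\<close>, this pushes \<open>m\<close> towards \<open>1\<close> as soon as \<open>E\<close> is small, and
  \<open>(1 - \<delta>) (1 - e^(-rt)) P* < P < (1 + \<delta> + L e^(-rt)) P*\<close> follows by a first-contact argument.
\<close>

section \<open>Growth of Brownian paths\<close>

text \<open>Induction on the level: an even index already occurs one level below, and an odd index
  \<open>2 * i + 1\<close> is a single increment away from such a point. Each level \<open>k\<close>
  therefore costs at most \<open>c * \<theta>^k\<close>.\<close>

lemma dyadic_chaining_bound:
  fixes f :: "real \<Rightarrow> real"
  assumes "f 0 = 0" "0 \<le> \<theta>"
    and incr: "\<And>k j. j < 2^k \<Longrightarrow> \<bar>f (T * real (Suc j) / 2^k) - f (T * real j / 2^k)\<bar> \<le> c * \<theta>^k"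
  shows "j \<le> 2^k \<Longrightarrow> \<bar>f (T * real j / 2^k)\<bar> \<le> c * (\<Sum>i\<le>k. \<theta>^i)"
proof (induction k arbitrary: j)
  case 0
  then have "j = 0 \<or> j = 1" by auto
  then show ?case
    using incr[of 0 0] assms(1) by auto
next
  case (Suc k)
  have "0 \<le> c" using incr[of 0 0] by simp
  show ?case
  proof (cases "even j")
    case True
    then obtain i where i: "j = 2 * i" by blast
    then have "\<bar>f (T * real i / 2^k)\<bar> \<le> c * (\<Sum>i\<le>k. \<theta>^i)" using Suc by simp
    also have "\<dots> \<le> c * (\<Sum>i\<le>Suc k. \<theta>^i)"
      using \<open>0 \<le> c\<close> assms(2) by (intro mult_left_mono) auto
    finally show ?thesis using i by simp
  next
    case False
    then obtain i where i: "j = Suc (2 * i)" by (metis oddE Suc_eq_plus1)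
    have "i \<le> 2^k" "2 * i < 2^Suc k" using Suc.prems i by auto
    have 1: "\<bar>f (T * real i / 2^k)\<bar> \<le> c * (\<Sum>i\<le>k. \<theta>^i)"
      using Suc.IH \<open>i \<le> 2^k\<close> by simp
    have 2: "\<bar>f (T * real j / 2^Suc k) - f (T * real i / 2^k)\<bar> \<le> c * \<theta>^Suc k"
      using incr[OF \<open>2 * i < 2^Suc k\<close>] unfolding i by simp
    show ?thesis using 1 2 by (simp add: distrib_left)
  qed
qed

text \<open>The geometric series makes the dyadic bound uniform in the level. Rounding
  \<open>t / T\<close> down to the dyadic grid gives points converging to \<open>t\<close>, so
  continuity carries the bound to \<open>t\<close>.\<close>

lemma continuous_dyadic_chaining_bound:
  fixes f :: "real \<Rightarrow> real"
  assumes "f 0 = 0" "0 \<le> \<theta>" "\<theta> < 1" "0 < T"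
    and cont: "continuous_on {0..} f"
    and incr: "\<And>k j. j < 2^k \<Longrightarrow> \<bar>f (T * real (Suc j) / 2^k) - f (T * real j / 2^k)\<bar> \<le> c * \<theta>^k"
    and t: "t \<in> {0..T}"
  shows "\<bar>f t\<bar> \<le> c / (1 - \<theta>)"
proof -
  have "0 \<le> c" using incr[of 0 0] by simp
  define j where "j k = nat \<lfloor>t / T * 2^k\<rfloor>" for k :: nat
  have j: "real (j k) = of_int \<lfloor>t / T * 2^k\<rfloor>" for k
    using t \<open>0 < T\<close> by (simp add: j_def)
  have j_le: "j k \<le> 2^k" for k
  proof -
    have "t / T * 2^k \<le> 2^k" using t \<open>0 < T\<close> by (simp add: field_simps)
    then have "real (j k) \<le> 2^k" unfolding j by linarith
    then show ?thesis by (metis of_nat_le_iff of_nat_power of_nat_numeral)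
  qed
  have bound: "\<bar>f (T * real (j k) / 2^k)\<bar> \<le> c / (1 - \<theta>)" for k
  proof -
    have "(\<Sum>i\<le>k. \<theta>^i) \<le> (\<Sum>i. \<theta>^i)"
      using assms(2,3) by (intro sum_le_suminf summable_geometric) auto
    also have "\<dots> = 1 / (1 - \<theta>)" using assms(2,3) by (intro suminf_geometric) auto
    finally have "c * (\<Sum>i\<le>k. \<theta>^i) \<le> c * (1 / (1 - \<theta>))"
      using \<open>0 \<le> c\<close> by (intro mult_left_mono)
    then show ?thesis
      using dyadic_chaining_bound[of f \<theta> T c "j k" k, OF assms(1,2) incr j_le] by simp
  qed
  have lim: "(\<lambda>k. T * real (j k) / 2^k) \<longlonglongrightarrow> t"
  proof (rule tendsto_sandwich)
    show "(\<lambda>k. t - T / 2^k) \<longlonglongrightarrow> t"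
      using tendsto_diff[OF tendsto_const LIMSEQ_divide_realpow_zero[of 2 T]] by simp
    show "(\<lambda>k. t) \<longlonglongrightarrow> t" by simp
    have "T * real (j k) / 2^k \<le> t \<and> t - T / 2^k \<le> T * real (j k) / 2^k" for k
    proof -
      have "real (j k) \<le> t / T * 2^k" "t / T * 2^k - 1 \<le> real (j k)" unfolding j by linarith+
      then have "T * real (j k) \<le> t * 2^k" "t * 2^k - T \<le> T * real (j k)"
        using \<open>0 < T\<close> by (auto simp: field_simps)
      then show ?thesis by (simp add: pos_divide_le_eq pos_le_divide_eq left_diff_distrib)
    qed
    then show "\<forall>\<^sub>F k in sequentially. t - T / 2^k \<le> T * real (j k) / 2^k"
      "\<forall>\<^sub>F k in sequentially. T * real (j k) / 2^k \<le> t" by auto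
  qed
  have "(\<lambda>k. f (T * real (j k) / 2^k)) \<longlonglongrightarrow> f t"
    using cont lim t \<open>0 < T\<close> by (intro continuous_on_tendsto_compose[OF cont lim]) auto
  then have "(\<lambda>k. \<bar>f (T * real (j k) / 2^k)\<bar>) \<longlonglongrightarrow> \<bar>f t\<bar>"
    by (rule tendsto_rabs)
  then show ?thesis
    using bound by (intro LIMSEQ_le_const2) auto
qed

section \<open>Fourth moments and almost sure growth of the paths\<close>

text \<open>The fourth moment is quadratic in \<open>t - s\<close>, so the sum over the
  \<open>2^k\<close> intervals of level \<open>k\<close> decays like \<open>2^-k\<close>. Second
  moments are only linear in \<open>t - s\<close>, and their sum would not decay.\<close>

lemma standard_BM_increment_fourth_moment:
  assumes "standard_BM M W" "0 \<le> s" "s < t"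
  shows "(\<integral>\<^sup>+\<omega>. ennreal ((W t \<omega> - W s \<omega>)^4) \<partial>M) = ennreal (3 * (t - s)^2)"
proof -
  have d: "distributed M lborel (\<lambda>\<omega>. W t \<omega> - W s \<omega>) (normal_density 0 (sqrt (t - s)))"
    using assms unfolding standard_BM_def by blast
  have "(\<integral>\<^sup>+\<omega>. ennreal ((W t \<omega> - W s \<omega>)^4) \<partial>M)
      = (\<integral>\<^sup>+x. ennreal (normal_density 0 (sqrt (t - s)) x) * ennreal (x^4) \<partial>lborel)"
    by (rule distributed_nn_integral[OF d, symmetric]) simp
  also have "\<dots> = (\<integral>\<^sup>+x. ennreal (normal_density 0 (sqrt (t - s)) x * (x - 0) ^ (2 * 2)) \<partial>lborel)"
    by (simp add: ennreal_mult)
  also have "\<dots> = ennreal (fact (2 * 2) / ((2 / (sqrt (t - s))\<^sup>2)^2 * fact 2))"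
    using assms normal_moment_even[of "sqrt (t - s)" 0 2]
    by (subst nn_integral_eq_integral) (auto simp: has_bochner_integral_iff)
  also have "fact (2 * 2) / ((2 / (sqrt (t - s))\<^sup>2)^2 * fact 2) = 3 * (t - s)^2"
    using assms by (simp add: fact_numeral power_divide)
  finally show ?thesis .
qed

text \<open>All normalised dyadic increments, over every interval \<open>{0..T m}\<close> and every
  level, enter one random sum \<open>Z\<close>. Its expectation is a multiple of the assumed
  convergent series, so \<open>Z\<close> is almost surely finite, and it then controls every
  increment at once. This is why \<open>C\<close> is uniform in \<open>m\<close>.\<close>

lemma standard_BM_sup_bound:
  assumes BM: "standard_BM M W"
    and T: "\<And>m. 0 < T m" and b: "\<And>m. 0 < b m"
    and summable: "summable (\<lambda>m::nat. (T m)^2 / (b m)^4)"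
  shows "AE \<omega> in M. \<exists>C. \<forall>m. \<forall>t\<in>{0..T m}. \<bar>W t \<omega>\<bar> \<le> C * b m"
proof -
  \<comment> \<open>The chaining sum converges for every \<open>\<theta> < 1\<close>, the sum of moments whenever \<open>2 \<theta>^4 > 1\<close>.\<close>
  define \<theta> :: real where "\<theta> = 9 / 10"
  define Y where "Y m k j \<omega> =
    ((W (T m * real (Suc j) / 2^k) \<omega> - W (T m * real j / 2^k) \<omega>) / (\<theta>^k * b m))^4" for m k j \<omega>
  define Z where "Z \<omega> = (\<Sum>m. \<Sum>k. \<Sum>j<2^k. ennreal (Y m k j \<omega>))" for \<omega>
  have meas: "W t \<in> borel_measurable M" if "0 \<le> t" for t
    using BM that unfolding standard_BM_def by blast
  have Tnn: "0 \<le> T m * real j / 2^k" for m j k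
    using T[of m] by simp
  have Ymeas: "Y m k j \<in> borel_measurable M" for m k j
    unfolding Y_def by (intro borel_measurable_power borel_measurable_divide borel_measurable_diff meas Tnn) auto
  have EY: "(\<integral>\<^sup>+\<omega>. ennreal (Y m k j \<omega>) \<partial>M)
      = ennreal (3 * ((T m)^2 / (b m)^4) * (1 / (4 * \<theta>^4))^k)" for m k j
  proof -
    have lt: "T m * real j / 2^k < T m * real (Suc j) / 2^k"
      using T[of m] by (simp add: divide_strict_right_mono)
    have pos: "0 < (\<theta>^k * b m)^4" using b[of m] by (simp add: \<theta>_def)
    have "(\<integral>\<^sup>+\<omega>. ennreal (Y m k j \<omega>) \<partial>M)
      = (\<integral>\<^sup>+\<omega>. ennreal (1 / (\<theta>^k * b m)^4) * ennreal ((W (T m * real (Suc j) / 2^k) \<omega> - W (T m * real j / 2^k) \<omega>)^4) \<partial>M)"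
      using pos by (simp add: Y_def power_divide flip: ennreal_mult)
    also have "\<dots> = ennreal (1 / (\<theta>^k * b m)^4) * (\<integral>\<^sup>+\<omega>. ennreal ((W (T m * real (Suc j) / 2^k) \<omega> - W (T m * real j / 2^k) \<omega>)^4) \<partial>M)"
      by (intro nn_integral_cmult measurable_compose[OF _ measurable_ennreal]
            borel_measurable_power borel_measurable_diff meas Tnn)
    also have "\<dots> = ennreal (1 / (\<theta>^k * b m)^4) * ennreal (3 * (T m * real (Suc j) / 2^k - T m * real j / 2^k)^2)"
      by (subst standard_BM_increment_fourth_moment[OF BM Tnn lt]) simp
    also have "\<dots> = ennreal (1 / (\<theta>^k * b m)^4 * (3 * (T m * real (Suc j) / 2^k - T m * real j / 2^k)^2))"
      using pos by (intro ennreal_mult[symmetric]) auto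
    also have "T m * real (Suc j) / 2^k - T m * real j / 2^k = T m / 2^k"
      by (simp add: field_simps)
    also have "1 / (\<theta>^k * b m)^4 * (3 * (T m / 2^k)^2) = 3 * ((T m)^2 / (b m)^4) * (1 / (4 * \<theta>^4))^k"
    proof -
      have "(\<theta>^k)^4 = (\<theta>^4)^k" by (simp add: mult.commute flip: power_mult)
      moreover have "((2::real)^k)^2 = 4^k"
        by (simp add: power2_eq_square flip: power_mult_distrib)
      ultimately show ?thesis by (simp add: power_mult_distrib power_divide field_simps)
    qed
    finally show ?thesis .
  qed
  \<comment> \<open>Level \<open>k\<close> has \<open>2^k\<close> increments, each with moment
    proportional to \<open>(1 / (4 * \<theta>^4))^k\<close>; together they form a geometric series
    of ratio \<open>r\<close>.\<close>
  define r where "r = 1 / (2 * \<theta>^4)"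
  have r: "0 \<le> r" "r < 1" by (auto simp: r_def \<theta>_def power4_eq_xxxx)
  have "(\<integral>\<^sup>+\<omega>. Z \<omega> \<partial>M) = (\<Sum>m. \<Sum>k. \<Sum>j<2^k. (\<integral>\<^sup>+\<omega>. ennreal (Y m k j \<omega>) \<partial>M))"
    unfolding Z_def using Ymeas
    by (simp add: nn_integral_suminf nn_integral_sum)
  also have "\<dots> = (\<Sum>m. \<Sum>k. ennreal (3 * ((T m)^2 / (b m)^4) * r^k))"
  proof -
    have "(\<Sum>j<(2::nat)^k. (\<integral>\<^sup>+\<omega>. ennreal (Y m k j \<omega>) \<partial>M)) = ennreal (3 * ((T m)^2 / (b m)^4) * r^k)" for m k
    proof -
      have "(\<Sum>j<(2::nat)^k. (\<integral>\<^sup>+\<omega>. ennreal (Y m k j \<omega>) \<partial>M))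
        = (\<Sum>j<(2::nat)^k. ennreal (3 * ((T m)^2 / (b m)^4) * (1 / (4 * \<theta>^4))^k))"
        unfolding EY ..
      also have "\<dots> = ennreal (\<Sum>j<(2::nat)^k. 3 * ((T m)^2 / (b m)^4) * (1 / (4 * \<theta>^4))^k)"
        by (intro sum_ennreal) (auto simp: \<theta>_def)
      also have "(\<Sum>j<(2::nat)^k. 3 * ((T m)^2 / (b m)^4) * (1 / (4 * \<theta>^4))^k)
        = 3 * ((T m)^2 / (b m)^4) * (2^k * (1 / (4 * \<theta>^4))^k)" by simp
      also have "2^k * (1 / (4 * \<theta>^4))^k = r^k"
        unfolding r_def power_mult_distrib[symmetric] by simp
      finally show ?thesis .
    qed
    then show ?thesis by simp
  qed
  also have "\<dots> = (\<Sum>m. ennreal (\<Sum>k. 3 * ((T m)^2 / (b m)^4) * r^k))"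
    using r by (intro suminf_cong suminf_ennreal2 summable_mult summable_geometric) auto
  also have "\<dots> = (\<Sum>m. ennreal (3 * ((T m)^2 / (b m)^4) * (1 / (1 - r))))"
    using r by (intro suminf_cong arg_cong[where f=ennreal])
       (subst suminf_mult, auto simp: suminf_geometric intro!: summable_geometric)
  also have "\<dots> = ennreal (\<Sum>m. 3 * ((T m)^2 / (b m)^4) * (1 / (1 - r)))"
    using r by (intro suminf_ennreal2 summable_mult2 summable_mult summable) auto
  finally have "(\<integral>\<^sup>+\<omega>. Z \<omega> \<partial>M) \<noteq> \<infinity>" by simp
  moreover have "Z \<in> borel_measurable M"
    unfolding Z_def using Ymeas by measurable
  ultimately have AEZ: "AE \<omega> in M. Z \<omega> \<noteq> \<infinity>"
    by (intro nn_integral_PInf_AE)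
  have "AE \<omega> in M. W 0 \<omega> = 0" "AE \<omega> in M. continuous_on {0..} (\<lambda>t. W t \<omega>)"
    using BM unfolding standard_BM_def by blast+
  with AEZ show ?thesis
  proof eventually_elim
    case (elim \<omega>)
    \<comment> \<open>A single nonnegative summand is at most the whole sum, so the fourth root of
      \<open>Z\<close> bounds every normalised increment. This is the constant that chaining
      requires.\<close>
    define z where "z = root 4 (enn2real (Z \<omega>))"
    have Y_le: "Y m k j \<omega> \<le> enn2real (Z \<omega>)" if "j < 2^k" for m k j
    proof -
      have "ennreal (Y m k j \<omega>) \<le> (\<Sum>j<2^k. ennreal (Y m k j \<omega>))"
        using that by (intro member_le_sum) auto
      also have "\<dots> \<le> (\<Sum>k. \<Sum>j<2^k. ennreal (Y m k j \<omega>))"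
        using sum_le_suminf[of "\<lambda>k. \<Sum>j<2^k. ennreal (Y m k j \<omega>)" "{k}"] by simp
      also have "\<dots> \<le> Z \<omega>"
        unfolding Z_def using sum_le_suminf[of "\<lambda>m. \<Sum>k. \<Sum>j<2^k. ennreal (Y m k j \<omega>)" "{m}"] by simp
      finally have "ennreal (Y m k j \<omega>) \<le> Z \<omega>" .
      then have "enn2real (ennreal (Y m k j \<omega>)) \<le> enn2real (Z \<omega>)"
        using elim(1) by (intro enn2real_mono) (auto simp: top.not_eq_extremum)
      then show ?thesis by (simp add: Y_def)
    qed
    have incr: "\<bar>W (T m * real (Suc j) / 2^k) \<omega> - W (T m * real j / 2^k) \<omega>\<bar> \<le> (z * b m) * \<theta>^k"
      if "j < 2^k" for m k j
    proof -
      define d where "d = W (T m * real (Suc j) / 2^k) \<omega> - W (T m * real j / 2^k) \<omega>"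
      have pos: "0 < \<theta>^k * b m" using b[of m] by (simp add: \<theta>_def)
      have "z^4 = enn2real (Z \<omega>)" "0 \<le> z" by (simp_all add: z_def)
      then have "(\<bar>d\<bar> / (\<theta>^k * b m))^4 \<le> z^4"
        using Y_le[OF that, of m] by (simp add: Y_def d_def power_divide power_even_abs)
      then have "\<bar>d\<bar> / (\<theta>^k * b m) \<le> z"
        using \<open>0 \<le> z\<close> by (rule power_le_imp_le_base[of _ 3, simplified])
      then have "\<bar>d\<bar> \<le> z * (\<theta>^k * b m)"
        using pos by (simp only: pos_divide_le_eq)
      then show ?thesis unfolding d_def by (simp only: mult_ac)
    qed
    have "\<bar>W t \<omega>\<bar> \<le> z * b m / (1 - \<theta>)" if "t \<in> {0..T m}" for m t
      using continuous_dyadic_chaining_bound[of "\<lambda>t. W t \<omega>" \<theta> "T m" "z * b m" t] elim(2,3) T incr that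
      by (simp add: \<theta>_def)
    then show ?case
      by (intro exI[of _ "z / (1 - \<theta>)"]) auto
  qed
qed

text \<open>The base 16 is a fourth power, so the exponents 3/4 and 1/4 turn its powers into powers
  of 8 and 2.\<close>

lemma power16_powr:
  "((16::real)^m) powr (3/4) = 8^m" "((16::real)^m) powr (1/4) = 2^m"
  "(1 / (16::real)^m) powr (1/4) = 1 / 2^m"
proof -
  have 2: "(0::real) < 2^m" by simp
  have "(16::real)^m = (2^m)^4" by (simp add: power4_eq_xxxx flip: power_mult_distrib)
  also have "\<dots> = (2^m) powr 4" using powr_realpow[OF 2, of 4] by simp
  finally have 16: "((16::real)^m) powr a = (2^m) powr (4 * a)" for a
    by (simp only: powr_powr)
  have "((2::real)^m) powr 3 = (2^m)^3" using powr_realpow[OF 2, of 3] by simp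
  also have "\<dots> = 8^m" by (simp add: power3_eq_cube flip: power_mult_distrib)
  finally show "((16::real)^m) powr (3/4) = 8^m" by (simp add: 16)
  show *: "((16::real)^m) powr (1/4) = 2^m" by (simp add: 16)
  show "(1 / (16::real)^m) powr (1/4) = 1 / 2^m"
    unfolding powr_divide * by simp
qed

text \<open>The sup bound is used with \<open>b = T powr (3/4)\<close> on long intervals and
  \<open>b = T powr (1/4)\<close> on short ones. In both cases \<open>T^2 / b^4\<close> is
  \<open>(1/16)^m\<close>, because 3/4 and 1/4 lie on opposite sides of the Brownian exponent 1/2.
  After division by \<open>t\<close>, the first power still vanishes at infinity and the second is
  integrable at 0.\<close>

lemma standard_BM_growth_bound:
  assumes BM: "standard_BM M W"
  shows "AE \<omega> in M. \<exists>C. \<forall>t>0. \<bar>W t \<omega>\<bar> \<le> C * (t powr (1/4) + t powr (3/4))"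
proof -
  have "AE \<omega> in M. \<exists>C. \<forall>m::nat. \<forall>t\<in>{0..16^m}. \<bar>W t \<omega>\<bar> \<le> C * 8^m"
  proof (rule standard_BM_sup_bound[OF BM])
    have "((16::real)^m)^2 / (8^m)^4 = (1/16)^m" for m
      by (simp add: power2_eq_square power4_eq_xxxx flip: power_mult_distrib power_divide)
    then show "summable (\<lambda>m. ((16::real)^m)^2 / (8^m)^4)"
      by (simp add: summable_geometric)
  qed auto
  moreover have "AE \<omega> in M. \<exists>C. \<forall>m::nat. \<forall>t\<in>{0..1 / 16^m}. \<bar>W t \<omega>\<bar> \<le> C * (1 / 2^m)"
  proof (rule standard_BM_sup_bound[OF BM])
    have "(1 / (16::real)^m)^2 / (1 / 2^m)^4 = (1/16)^m" for m
      by (simp add: power2_eq_square power4_eq_xxxx flip: power_mult_distrib power_divide)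
    then show "summable (\<lambda>m. (1 / (16::real)^m)^2 / (1 / 2^m)^4)"
      by (simp add: summable_geometric)
  qed auto
  ultimately show ?thesis
  proof eventually_elim
    case (elim \<omega>)
    obtain C1 where C1: "\<And>m t. t \<in> {0..16^m} \<Longrightarrow> \<bar>W t \<omega>\<bar> \<le> C1 * 8^m" using elim(1) by blast
    obtain C2 where C2: "\<And>m t. t \<in> {0..1 / 16^m} \<Longrightarrow> \<bar>W t \<omega>\<bar> \<le> C2 * (1 / 2^m)" using elim(2) by blast
    have C12: "0 \<le> C1" "0 \<le> C2" using C1[of 0 0] C2[of 0 0] by auto
    \<comment> \<open>The factors 8 and 2 are the losses from rounding \<open>t\<close> up to a
      power of 16: they equal \<open>16 powr (3/4)\<close> and \<open>16 powr (1/4)\<close>.\<close>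
    define C where "C = 8 * C1 + 2 * C2"
    have "\<bar>W t \<omega>\<bar> \<le> C * (t powr (1/4) + t powr (3/4))" if t: "0 < t" for t
    proof (cases "1 \<le> t")
      case True
      define m where "m = (LEAST m. t \<le> 16^m)"
      obtain m0 where "t \<le> 16^m0"
        using real_arch_pow[of 16 t] by (auto intro: less_imp_le)
      then have m: "t \<le> 16^m" unfolding m_def by (rule LeastI)
      have "8^m \<le> 8 * t powr (3/4)"
      proof (cases m)
        case 0
        then show ?thesis using True ge_one_powr_ge_zero[of t "3/4"] by simp
      next
        case (Suc n)
        have "\<not> t \<le> 16^n" using not_less_Least[of n "\<lambda>m. t \<le> 16^m"] Suc unfolding m_def by simp
        then have "(16^n) powr (3/4) \<le> t powr (3/4)" by (intro powr_mono2) auto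
        then show ?thesis by (simp add: power16_powr Suc)
      qed
      then have "C1 * 8^m \<le> C1 * (8 * t powr (3/4))" using C12 by (intro mult_left_mono)
      then have "\<bar>W t \<omega>\<bar> \<le> C1 * (8 * t powr (3/4))"
        using C1[of t m] m t by simp
      moreover have "0 \<le> C1 * t powr (1/4)" "0 \<le> C2 * t powr (1/4)" "0 \<le> C2 * t powr (3/4)"
        using C12 by auto
      ultimately show ?thesis by (simp add: C_def algebra_simps)
    next
      case False
      \<comment> \<open>As \<open>t < 1\<close>, this \<open>m\<close> is positive. Its predecessor
        \<open>n\<close> satisfies \<open>t \<le> 1 / 16^n\<close>, so the bound on the interval of
        index \<open>n\<close> applies, while \<open>1 / 16^m < t\<close> compares it with a power
        of \<open>t\<close>.\<close>
      define m where "m = (LEAST m. 1 / 16^m < t)"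
      obtain m0 where "(1/16)^m0 < t"
        using real_arch_pow_inv[of t "1/16"] t by auto
      then have "1 / 16^m0 < t" by (simp add: power_one_over)
      then have m: "1 / 16^m < t" unfolding m_def by (rule LeastI)
      then obtain n where n: "m = Suc n" using False by (cases m) auto
      have "\<not> 1 / 16^n < t" using not_less_Least[of n "\<lambda>m. 1 / 16^m < t"] n unfolding m_def by simp
      then have "\<bar>W t \<omega>\<bar> \<le> C2 * (1 / 2^n)" using t by (intro C2) auto
      also have "1 / 2^n \<le> 2 * t powr (1/4)"
      proof -
        have "(1 / 16^m) powr (1/4) \<le> t powr (1/4)" using m by (intro powr_mono2) auto
        then show ?thesis by (simp only: power16_powr) (simp add: n)
      qed
      finally have "\<bar>W t \<omega>\<bar> \<le> C2 * (2 * t powr (1/4))" using C12 by (simp add: mult_left_mono)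
      moreover have "0 \<le> C1 * t powr (1/4)" "0 \<le> C1 * t powr (3/4)" "0 \<le> C2 * t powr (3/4)"
        using C12 by auto
      ultimately show ?thesis by (simp add: C_def algebra_simps)
    qed
    then show ?case by blast
  qed
qed

section \<open>Positive definite matrices\<close>

lemma bounded_bilinear_matrix_matrix_mult:
  "bounded_bilinear ((**) :: real^'n^'m \<Rightarrow> real^'p^'n \<Rightarrow> real^'p^'m)"
  unfolding bilinear_conv_bounded_bilinear[symmetric] bilinear_def
  by (auto intro!: linearI simp: matrix_matrix_mult_def vec_eq_iff sum.distrib sum_distrib_left algebra_simps)

lemma bounded_bilinear_matrix_vector_mult:
  "bounded_bilinear ((*v) :: real^'n^'m \<Rightarrow> real^'n \<Rightarrow> real^'m)"
  unfolding bilinear_conv_bounded_bilinear[symmetric] bilinear_def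
  by (auto intro!: linearI simp: matrix_vector_mult_def vec_eq_iff sum.distrib sum_distrib_left algebra_simps)

lemma bounded_linear_transpose: "bounded_linear (transpose :: real^'n^'m \<Rightarrow> real^'m^'n)"
  unfolding linear_conv_bounded_linear[symmetric]
  by (auto intro!: linearI simp: transpose_def vec_eq_iff)

lemma norm_transpose: "norm (transpose (A :: real^'n^'m)) = norm A"
  unfolding norm_eq_sqrt_inner inner_vec_def transpose_def
  by simp (rule sum.swap)

lemma inner_transpose_mult: "x \<bullet> (transpose (A :: real^'n^'m) *v y) = (A *v x) \<bullet> y"
  by (metis dot_lmul_matrix inner_commute transpose_matrix_vector)

lemma symmetric_inner_mult:
  "transpose A = A \<Longrightarrow> x \<bullet> ((A :: real^'n^'n) *v y) = (A *v x) \<bullet> y"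
  using inner_transpose_mult[of x A y] by simp

lemma bounded_linear_quadratic_form: "bounded_linear (\<lambda>M :: real^'n^'n. x \<bullet> (M *v x))"
  by (intro bounded_linear_compose[OF bounded_linear_inner_right]
        bounded_bilinear.bounded_linear_left[OF bounded_bilinear_matrix_vector_mult])

lemma continuous_on_quadratic_form:
  fixes M :: "'b::topological_space \<Rightarrow> real^'n^'n"
  assumes "continuous_on S M" "continuous_on S x"
  shows "continuous_on S (\<lambda>t. x t \<bullet> (M t *v x t))"
  using assms by (intro continuous_on_inner bounded_bilinear.continuous_on[OF bounded_bilinear_matrix_vector_mult])

lemma quadratic_form_scaleR:
  "(c *\<^sub>R x) \<bullet> ((M :: real^'n^'n) *v (c *\<^sub>R x)) = c^2 * (x \<bullet> (M *v x))"
  by (simp add: matrix_vector_mult_scaleR power2_eq_square)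

text \<open>By homogeneity it is enough to test unit vectors. The gain is compactness, used for
  minima and for first contact times.\<close>

lemma sym_posdef_iff_sphere:
  "sym_posdef (M :: real^'n^'n) \<longleftrightarrow> transpose M = M \<and> (\<forall>x\<in>sphere 0 1. 0 < x \<bullet> (M *v x))"
proof -
  have "0 < x \<bullet> (M *v x)" if sphere: "\<forall>x\<in>sphere 0 1. 0 < x \<bullet> (M *v x)" and "x \<noteq> 0" for x
  proof -
    have "0 < (norm x)^2 * ((x /\<^sub>R norm x) \<bullet> (M *v (x /\<^sub>R norm x)))"
      using that by (intro mult_pos_pos bspec[OF sphere]) auto
    also have "\<dots> = (norm x *\<^sub>R (x /\<^sub>R norm x)) \<bullet> (M *v (norm x *\<^sub>R (x /\<^sub>R norm x)))"
      by (rule quadratic_form_scaleR[symmetric])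
    finally show ?thesis using \<open>x \<noteq> 0\<close> by simp
  qed
  then show ?thesis unfolding sym_posdef_def by (metis norm_zero zero_neq_one mem_sphere_0)
qed

lemma sym_posdef_lower_bound:
  fixes M :: "real^'n^'n"
  assumes "sym_posdef M"
  shows "\<exists>c>0. \<forall>x. c * (x \<bullet> x) \<le> x \<bullet> (M *v x)"
proof -
  have "(axis undefined 1 :: real^'n) \<in> sphere 0 1" by (simp add: norm_axis_1)
  then have ne: "sphere (0::real^'n) 1 \<noteq> {}" by blast
  have "continuous_on (sphere 0 1) (\<lambda>x. x \<bullet> (M *v x))"
    by (intro continuous_on_quadratic_form continuous_intros)
  then obtain y where y: "y \<in> sphere 0 1" "\<And>x. x \<in> sphere 0 1 \<Longrightarrow> y \<bullet> (M *v y) \<le> x \<bullet> (M *v x)"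
    using continuous_attains_inf[OF compact_sphere ne] by blast
  have "(y \<bullet> (M *v y)) * (x \<bullet> x) \<le> x \<bullet> (M *v x)" for x
  proof (cases "x = 0")
    case False
    then have "x /\<^sub>R norm x \<in> sphere 0 1" by simp
    then have "(norm x)^2 * (y \<bullet> (M *v y)) \<le> (norm x)^2 * ((x /\<^sub>R norm x) \<bullet> (M *v (x /\<^sub>R norm x)))"
      by (intro mult_left_mono y(2)) auto
    also have "\<dots> = (norm x *\<^sub>R (x /\<^sub>R norm x)) \<bullet> (M *v (norm x *\<^sub>R (x /\<^sub>R norm x)))"
      by (rule quadratic_form_scaleR[symmetric])
    finally show ?thesis using False by (simp add: power2_norm_eq_inner mult.commute)
  qed simp
  moreover have "0 < y \<bullet> (M *v y)" using assms y(1) by (simp add: sym_posdef_iff_sphere)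
  ultimately show ?thesis by blast
qed

text \<open>Moving from \<open>x\<close> by \<open>- s *\<^sub>R (M *v x)\<close> changes the form
  by a negative term linear in \<open>s\<close> plus a quadratic one. If \<open>M *v x\<close> were
  nonzero, the form would be negative for small \<open>s > 0\<close>.\<close>

lemma psd_quadratic_form_zero:
  fixes M :: "real^'n^'n"
  assumes sym: "transpose M = M" and psd: "\<And>y. 0 \<le> y \<bullet> (M *v y)" and "x \<bullet> (M *v x) = 0"
  shows "M *v x = 0"
proof (rule ccontr)
  define y where "y = M *v x"
  define b where "b = y \<bullet> (M *v y)"
  assume "M *v x \<noteq> 0"
  then have y: "0 < y \<bullet> y" by (simp add: y_def)
  have b: "0 \<le> b" unfolding b_def by (rule psd)
  have "(x - s *\<^sub>R y) \<bullet> (M *v (x - s *\<^sub>R y)) = s^2 * b - 2 * s * (y \<bullet> y)" for s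
  proof -
    have "x \<bullet> (M *v y) = y \<bullet> y" using symmetric_inner_mult[OF sym] by (simp add: y_def)
    moreover have "M *v x = y" by (simp add: y_def)
    ultimately show ?thesis using assms(3)
      by (simp add: matrix_vector_mult_diff_distrib matrix_vector_mult_scaleR inner_diff_left
          inner_diff_right b_def power2_eq_square algebra_simps)
  qed
  then have *: "2 * s * (y \<bullet> y) \<le> s^2 * b" for s by (metis psd diff_ge_0_iff_ge)
  \<comment> \<open>The \<open>+ 1\<close> covers \<open>b = 0\<close>. With this \<open>s\<close>,
    the product \<open>s * b\<close> is at most \<open>y \<bullet> y\<close>, whereas
    semidefiniteness asks for at least twice that.\<close>
  define s where "s = (y \<bullet> y) / (b + 1)"
  have s: "0 < s" using y b by (simp add: s_def)
  have "s * (2 * (y \<bullet> y)) \<le> s * (s * b)" using *[of s] by (simp add: power2_eq_square mult_ac)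
  then have "2 * (y \<bullet> y) \<le> s * b" using s by simp
  also have "s * b \<le> s * (b + 1)" using s by (simp add: distrib_left)
  also have "\<dots> = y \<bullet> y" using b by (simp add: s_def)
  finally show False using y by simp
qed

section \<open>First contact and Gronwall arguments\<close>

text \<open>At the first time when definiteness fails, \<open>G\<close> is still semidefinite, so a
  vector on which the form vanishes lies in the kernel. Hence the derivative condition is imposed on
  kernel vectors only. A positive derivative there would make the form negative just before
  contact.\<close>

lemma sym_posdef_barrier:
  fixes G G' :: "real \<Rightarrow> real^'n^'n"
  assumes cont: "continuous_on {a..} G"
    and sym: "\<And>t. a \<le> t \<Longrightarrow> transpose (G t) = G t"
    and init: "sym_posdef (G a)"
    and deriv: "\<And>t. a < t \<Longrightarrow> (G has_vector_derivative G' t) (at t)"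
    and barrier: "\<And>t x. a < t \<Longrightarrow> x \<noteq> 0 \<Longrightarrow> G t *v x = 0 \<Longrightarrow> 0 < x \<bullet> (G' t *v x)"
    and "a \<le> t0"
  shows "sym_posdef (G t0)"
proof (rule ccontr)
  assume contr: "\<not> sym_posdef (G t0)"
  \<comment> \<open>\<open>K\<close> collects times of failure together with witnessing unit
    vectors. It is compact, so a first failure is attained along with its vector.\<close>
  define K where "K = {p \<in> {a..t0} \<times> sphere 0 1. snd p \<bullet> (G (fst p) *v snd p) \<le> 0}"
  have "continuous_on ({a..t0} \<times> sphere 0 1) (\<lambda>p. snd p \<bullet> (G (fst p) *v snd p))"
    by (intro continuous_on_quadratic_form continuous_intros continuous_on_compose2[OF cont]) auto
  then have "closedin (top_of_set ({a..t0} \<times> sphere 0 1)) K"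
    using continuous_closedin_preimage[OF _ closed_atMost[of 0]] by (simp add: K_def vimage_def Int_def)
  then have "compact K"
    by (rule closedin_compact[rotated]) (intro compact_Times compact_Icc compact_sphere)
  moreover have "K \<noteq> {}"
    using contr sym[OF \<open>a \<le> t0\<close>] \<open>a \<le> t0\<close>
    by (force simp: sym_posdef_iff_sphere K_def not_less)
  ultimately obtain p where p: "p \<in> K" "\<And>q. q \<in> K \<Longrightarrow> fst p \<le> fst q"
    using continuous_attains_inf[of K fst] continuous_on_fst[OF continuous_on_id] by blast
  obtain t1 x1 where tx: "p = (t1, x1)" by (cases p)
  have t1: "a \<le> t1" "t1 \<le> t0" "norm x1 = 1" "x1 \<bullet> (G t1 *v x1) \<le> 0"
    using p(1) by (auto simp: K_def tx)
  have x1: "x1 \<noteq> 0" using t1(3) by auto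
  have "t1 \<noteq> a" using init t1(3,4) unfolding sym_posdef_iff_sphere by force
  then have "a < t1" using t1 by simp
  have before: "sym_posdef (G t)" if "a \<le> t" "t < t1" for t
    unfolding sym_posdef_iff_sphere
  proof (intro conjI ballI)
    fix x :: "real^'n" assume "x \<in> sphere 0 1"
    then show "0 < x \<bullet> (G t *v x)"
      using p(2)[of "(t, x)"] that t1 by (force simp: K_def tx)
  qed (use sym that in simp)
  have psd: "0 \<le> x \<bullet> (G t1 *v x)" for x
  proof (rule tendsto_lowerbound)
    have "isCont G t1"
      using deriv[OF \<open>a < t1\<close>] by (rule has_vector_derivative_continuous)
    then have "isCont (\<lambda>t. x \<bullet> (G t *v x)) t1"
      by (rule bounded_linear.isCont[OF bounded_linear_quadratic_form])
    then show "((\<lambda>t. x \<bullet> (G t *v x)) \<longlongrightarrow> x \<bullet> (G t1 *v x)) (at_left t1)"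
      by (simp add: isCont_def filterlim_at_split)
    have "\<forall>\<^sub>F t in at_left t1. t \<in> {a<..<t1}"
      using \<open>a < t1\<close> by (rule eventually_at_left_real)
    then show "\<forall>\<^sub>F t in at_left t1. 0 \<le> x \<bullet> (G t *v x)"
    proof eventually_elim
      case (elim t)
      then have "sym_posdef (G t)" by (intro before) auto
      then show ?case unfolding sym_posdef_def by (cases "x = 0") (auto intro: less_imp_le)
    qed
  qed simp
  have zero: "x1 \<bullet> (G t1 *v x1) = 0" using psd[of x1] t1(4) by simp
  have "G t1 *v x1 = 0"
    using psd_quadratic_form_zero[OF sym[OF t1(1)] psd zero] .
  then have pos: "0 < x1 \<bullet> (G' t1 *v x1)" using barrier \<open>a < t1\<close> x1 by blast
  have "((\<lambda>t. x1 \<bullet> (G t *v x1)) has_vector_derivative x1 \<bullet> (G' t1 *v x1)) (at t1)"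
    using bounded_linear.has_vector_derivative[OF bounded_linear_quadratic_form deriv[OF \<open>a < t1\<close>]] .
  then have "((\<lambda>t. x1 \<bullet> (G t *v x1)) has_real_derivative x1 \<bullet> (G' t1 *v x1)) (at t1)"
    by (simp add: has_real_derivative_iff_has_vector_derivative)
  then obtain d where d: "0 < d" "\<And>h. 0 < h \<Longrightarrow> h < d \<Longrightarrow> x1 \<bullet> (G (t1 - h) *v x1) < x1 \<bullet> (G t1 *v x1)"
    using DERIV_pos_inc_left[OF _ pos] by blast
  \<comment> \<open>The step back must be shorter than \<open>d\<close> and must not leave the
    interval on the left of \<open>t1\<close> where definiteness is known.\<close>
  define h where "h = min (d / 2) (t1 - a)"
  have h: "0 < h" "h < d" "a \<le> t1 - h" "t1 - h < t1" using d(1) \<open>a < t1\<close> by (auto simp: h_def)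
  then have "0 < x1 \<bullet> (G (t1 - h) *v x1)"
    using before[of "t1 - h"] x1 unfolding sym_posdef_def by blast
  then show False using d(2)[OF h(1,2)] zero by simp
qed

text \<open>The weighted square norm \<open>\<phi>\<close> is nonincreasing, nonnegative and starts
  at 0. The rate \<open>g\<close> enters through an antiderivative \<open>G\<close> continuous on
  the closed interval, so \<open>g\<close> may blow up at 0 as long as it stays integrable.\<close>

lemma gronwall_zero:
  fixes Z Z' :: "real \<Rightarrow> 'b::real_inner"
  assumes "0 \<le> T" and contZ: "continuous_on {0..T} Z" and contG: "continuous_on {0..T} G"
    and derivZ: "\<And>t. 0 < t \<Longrightarrow> t < T \<Longrightarrow> (Z has_vector_derivative Z' t) (at t)"
    and derivG: "\<And>t. 0 < t \<Longrightarrow> t < T \<Longrightarrow> (G has_real_derivative g t) (at t)"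
    and bound: "\<And>t. 0 < t \<Longrightarrow> t < T \<Longrightarrow> norm (Z' t) \<le> g t * norm (Z t)"
    and "Z 0 = 0"
  shows "Z T = 0"
proof -
  define \<phi> where "\<phi> t = (Z t \<bullet> Z t) * exp (- 2 * G t)" for t
  have "\<phi> T \<le> \<phi> 0"
  proof (rule DERIV_nonpos_imp_decreasing_open[OF \<open>0 \<le> T\<close>])
    fix t assume t: "0 < t" "t < T"
    have "((\<lambda>t. Z t \<bullet> Z t) has_vector_derivative (Z t \<bullet> Z' t + Z' t \<bullet> Z t)) (at t)"
      by (rule bounded_bilinear.has_vector_derivative[OF bounded_bilinear_inner derivZ[OF t] derivZ[OF t]])
    then have 1: "((\<lambda>t. Z t \<bullet> Z t) has_real_derivative 2 * (Z t \<bullet> Z' t)) (at t)"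
      by (simp add: has_real_derivative_iff_has_vector_derivative inner_commute)
    have "(\<phi> has_real_derivative 2 * (Z t \<bullet> Z' t) * exp (- 2 * G t)
        + (Z t \<bullet> Z t) * (exp (- 2 * G t) * (- 2 * g t))) (at t)"
      unfolding \<phi>_def by (auto intro!: derivative_eq_intros 1 derivG[OF t])
    moreover have "2 * (Z t \<bullet> Z' t) * exp (- 2 * G t)
        + (Z t \<bullet> Z t) * (exp (- 2 * G t) * (- 2 * g t)) \<le> 0"
    proof -
      have "Z t \<bullet> Z' t \<le> norm (Z t) * norm (Z' t)" by (rule norm_cauchy_schwarz)
      also have "\<dots> \<le> norm (Z t) * (g t * norm (Z t))"
        using bound[OF t] by (intro mult_left_mono) auto
      also have "\<dots> = g t * (Z t \<bullet> Z t)" by (simp add: norm_eq_sqrt_inner)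
      finally have "(Z t \<bullet> Z' t) * (2 * exp (- 2 * G t)) \<le> (g t * (Z t \<bullet> Z t)) * (2 * exp (- 2 * G t))"
        by (intro mult_right_mono) auto
      then show ?thesis by (simp add: algebra_simps)
    qed
    ultimately show "\<exists>y. (\<phi> has_real_derivative y) (at t) \<and> y \<le> 0" by blast
  next
    show "continuous_on {0..T} \<phi>"
      unfolding \<phi>_def by (intro continuous_intros contZ contG)
  qed
  then have "(Z T \<bullet> Z T) * exp (- 2 * G T) \<le> 0" by (simp add: \<phi>_def \<open>Z 0 = 0\<close>)
  then have "Z T \<bullet> Z T \<le> 0" by (simp add: mult_le_0_iff)
  then show ?thesis by (metis inner_gt_zero_iff not_le)
qed

section \<open>The perturbed Riccati equation\<close>

text \<open>Definiteness makes \<open>R\<close> injective, hence invertible, and the form of the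
  inverse at \<open>y\<close> is the form of \<open>R\<close> at
  \<open>matrix_inv R *v y\<close>.\<close>

lemma sym_posdef_matrix_inv:
  fixes R :: "real^'m^'m"
  assumes R: "sym_posdef R"
  shows "transpose (matrix_inv R) = matrix_inv R" "0 \<le> y \<bullet> (matrix_inv R *v y)"
proof -
  have "\<forall>x y. R *v x = R *v y \<longrightarrow> x = y"
  proof (intro allI impI, rule ccontr)
    fix x y assume "R *v x = R *v y" "x \<noteq> y"
    then have "R *v (x - y) = 0" "x - y \<noteq> 0" by (auto simp: matrix_vector_mult_diff_distrib)
    then show False using R unfolding sym_posdef_def by (metis inner_zero_right less_irrefl)
  qed
  then have "inj ((*v) R)" by (auto intro: injI)
  then have "\<exists>L. L ** R = mat 1 \<and> R ** L = mat 1"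
    using matrix_left_invertible_injective[of R] matrix_left_right_inverse[of _ R] by blast
  \<comment> \<open>\<open>matrix_inv\<close> is defined by choice, so its equations follow only
    once a two-sided inverse is known to exist.\<close>
  then have inv: "R ** matrix_inv R = mat 1 \<and> matrix_inv R ** R = mat 1"
    unfolding matrix_inv_def by (intro someI_ex[where P="\<lambda>L. R ** L = mat 1 \<and> L ** R = mat 1"]) blast
  have "transpose (R ** matrix_inv R) = mat 1" using inv by (simp add: transpose_mat)
  then have *: "transpose (matrix_inv R) ** R = mat 1"
    using R by (simp add: matrix_transpose_mul sym_posdef_def)
  have "transpose (matrix_inv R) = transpose (matrix_inv R) ** (R ** matrix_inv R)"
    using inv by simp
  also have "\<dots> = matrix_inv R" unfolding matrix_mul_assoc * by simp
  finally show "transpose (matrix_inv R) = matrix_inv R" .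
  define z where "z = matrix_inv R *v y"
  have "R *v z = y" using inv by (simp add: z_def matrix_vector_mul_assoc)
  moreover have "0 \<le> z \<bullet> (R *v z)"
    using R unfolding sym_posdef_def by (cases "z = 0") (auto intro: less_imp_le)
  ultimately show "0 \<le> y \<bullet> (matrix_inv R *v y)" by (simp add: z_def inner_commute)
qed

text \<open>The antisymmetric part \<open>Z\<close> solves a linear equation with zero initial
  value. Its coefficients are bounded on \<open>{0..T}\<close> except for the noise, whose bound is
  integrable at 0, so Gronwall gives \<open>Z T = 0\<close>.\<close>

lemma riccati_symmetric:
  fixes A Q :: "real^'n^'n" and B :: "real^'m^'n" and E P :: "real \<Rightarrow> real^'n^'n"
  assumes Q: "sym_posdef Q" and R: "sym_posdef R"
    and init: "transpose (P 0) = P 0" and cont: "continuous_on {0..} P"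
    and deriv: "\<And>t. 0 < t \<Longrightarrow> (P has_vector_derivative riccati_rhs (A + E t) B Q R (P t)) (at t)"
    and E: "\<And>t. 0 < t \<Longrightarrow> norm (E t) \<le> C * (t powr (-3/4) + t powr (-1/4))"
    and "0 \<le> T"
  shows "transpose (P T) = P T"
proof -
  define S where "S = B ** matrix_inv R ** transpose B"
  have S: "transpose S = S"
    by (simp add: S_def matrix_transpose_mul sym_posdef_matrix_inv(1)[OF R] matrix_mul_assoc)
  define Z where "Z t = P t - transpose (P t)" for t
  \<comment> \<open>The difference of the quadratic term and its transpose is split through
    \<open>transpose (P t) ** S ** P t\<close>, so that each piece has a factor
    \<open>Z t\<close>.\<close>
  define Z' where "Z' t = transpose (A + E t) ** Z t + Z t ** (A + E t)
    - (Z t ** S ** P t + transpose (P t) ** S ** Z t)" for t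
  have rhs: "riccati_rhs F B Q R X = transpose F ** X + X ** F - X ** S ** X + Q" for F X
    by (simp add: riccati_rhs_def S_def matrix_mul_assoc)
  have Qt: "transpose Q = Q" using Q by (simp add: sym_posdef_def)
  note tr = bounded_linear_transpose[where 'n='n and 'm='n]
  note mm = bounded_bilinear_matrix_matrix_mult[where 'n='n and 'm='n and 'p='n]
  from bounded_bilinear.pos_bounded[OF mm] obtain k
    where k: "0 < k" "\<And>(X :: real^'n^'n) (Y :: real^'n^'n). norm (X ** Y) \<le> norm X * norm Y * k" by auto
  have "bounded (P ` {0..T})"
    by (intro compact_imp_bounded compact_continuous_image compact_Icc continuous_on_subset[OF cont]) auto
  then obtain b where b: "0 < b" "\<And>t. t \<in> {0..T} \<Longrightarrow> norm (P t) \<le> b"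
    unfolding bounded_pos by auto
  define c0 where "c0 = 2 * k * norm A + 2 * k^2 * norm S * b"
  define c1 where "c1 = 2 * k * C"
  have "Z T = 0"
  proof (rule gronwall_zero[OF \<open>0 \<le> T\<close>])
    show "continuous_on {0..T} Z"
      unfolding Z_def by (intro continuous_intros bounded_linear.continuous_on[OF tr] continuous_on_subset[OF cont]) auto
    \<comment> \<open>An explicit antiderivative of the rate, continuous at 0 although the rate
      itself is singular there.\<close>
    show "continuous_on {0..T} (\<lambda>t. c0 * t + c1 * (4 * t powr (1/4) + 4/3 * t powr (3/4)))"
      by (intro continuous_intros continuous_on_powr') auto
    show "Z 0 = 0" by (simp add: Z_def init)
    fix t assume t: "0 < t" "t < T"
    show "((\<lambda>t. c0 * t + c1 * (4 * t powr (1/4) + 4/3 * t powr (3/4))) has_real_derivative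
        c0 + c1 * (t powr (-3/4) + t powr (-1/4))) (at t)"
      using t by (auto intro!: derivative_eq_intros)
    have "(Z has_vector_derivative riccati_rhs (A + E t) B Q R (P t) - transpose (riccati_rhs (A + E t) B Q R (P t))) (at t)"
      unfolding Z_def by (intro has_vector_derivative_diff bounded_linear.has_vector_derivative[OF tr] deriv t)
    also have "riccati_rhs (A + E t) B Q R (P t) - transpose (riccati_rhs (A + E t) B Q R (P t)) = Z' t"
      unfolding rhs Z'_def Z_def using bounded_linear.linear[OF tr]
      by (simp add: linear_add linear_diff matrix_transpose_mul S Qt
           bounded_bilinear.diff_left[OF mm] bounded_bilinear.diff_right[OF mm] bounded_bilinear.add_left[OF mm] bounded_bilinear.add_right[OF mm] matrix_mul_assoc)
    finally show "(Z has_vector_derivative Z' t) (at t)" .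
    have nE: "norm (A + E t) \<le> norm A + C * (t powr (-3/4) + t powr (-1/4))"
      using norm_triangle_ineq[of A "E t"] E[OF t(1)] by linarith
    have nP: "norm (P t) \<le> b" using b(2) t by simp
    have 1: "norm (transpose (A + E t) ** Z t) \<le> norm (A + E t) * norm (Z t) * k"
      "norm (Z t ** (A + E t)) \<le> norm (A + E t) * norm (Z t) * k"
      using k(2)[of "transpose (A + E t)" "Z t"] k(2)[of "Z t" "A + E t"]
      by (simp_all add: norm_transpose mult_ac)
    have 2: "norm (X ** S ** Y) \<le> k^2 * norm S * norm X * norm Y" for X Y :: "real^'n^'n"
    proof -
      have "norm (X ** S ** Y) \<le> norm (X ** S) * norm Y * k" by (rule k)
      also have "\<dots> \<le> (norm X * norm S * k) * norm Y * k"
        using k(1) by (intro mult_right_mono k(2)) auto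
      finally show ?thesis by (simp add: power2_eq_square mult_ac)
    qed
    have 3: "k^2 * norm S * norm (Z t) * norm (P t) \<le> k^2 * norm S * norm (Z t) * b"
      using nP by (intro mult_left_mono) auto
    have "norm (Z' t) \<le> norm (transpose (A + E t) ** Z t) + norm (Z t ** (A + E t))
        + (norm (Z t ** S ** P t) + norm (transpose (P t) ** S ** Z t))"
      unfolding Z'_def by (intro norm_triangle_le_diff add_mono norm_triangle_ineq)
    also have "\<dots> \<le> 2 * (norm (A + E t) * norm (Z t) * k) + 2 * (k^2 * norm S * norm (Z t) * b)"
      using 1 2[of "Z t" "P t"] 2[of "transpose (P t)" "Z t"] 3
      by (simp add: norm_transpose mult_ac)
    also have "\<dots> \<le> 2 * ((norm A + C * (t powr (-3/4) + t powr (-1/4))) * norm (Z t) * k) + 2 * (k^2 * norm S * norm (Z t) * b)"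
      using k(1) by (intro add_right_mono mult_left_mono mult_right_mono nE) auto
    also have "\<dots> = (c0 + c1 * (t powr (-3/4) + t powr (-1/4))) * norm (Z t)"
      by (simp add: c0_def c1_def algebra_simps)
    finally show "norm (Z' t) \<le> (c0 + c1 * (t powr (-3/4) + t powr (-1/4))) * norm (Z t)" .
  qed
  then show ?thesis by (simp add: Z_def)
qed

section \<open>Comparison with multiples of \<open>Pstar\<close>\<close>

text \<open>The right side depends on \<open>X\<close> only through the vector
  \<open>X *v x\<close>, which lets a contact relation be substituted directly.\<close>

lemma riccati_quadratic_form:
  fixes F :: "real^'n^'n" and B :: "real^'m^'n"
  assumes "transpose X = X"
  shows "x \<bullet> (riccati_rhs F B Q R X *v x) = 2 * ((F *v x) \<bullet> (X *v x))
    - (transpose B *v (X *v x)) \<bullet> (matrix_inv R *v (transpose B *v (X *v x))) + x \<bullet> (Q *v x)"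
proof -
  have "x \<bullet> ((X ** F) *v x) = (F *v x) \<bullet> (X *v x)"
    using symmetric_inner_mult[OF assms, of x "F *v x"]
    by (simp add: inner_commute flip: matrix_vector_mul_assoc)
  moreover have "x \<bullet> ((transpose F ** X) *v x) = (F *v x) \<bullet> (X *v x)"
    by (simp only: inner_transpose_mult flip: matrix_vector_mul_assoc)
  moreover have "x \<bullet> ((X ** B ** matrix_inv R ** transpose B ** X) *v x)
    = (transpose B *v (X *v x)) \<bullet> (matrix_inv R *v (transpose B *v (X *v x)))"
    using symmetric_inner_mult[OF assms, of x] inner_transpose_mult[of _ "transpose B"]
    by (simp only: transpose_transpose flip: matrix_vector_mul_assoc)
  ultimately show ?thesis
    unfolding riccati_rhs_def
    by (simp only: matrix_vector_mult_add_rdistrib matrix_vector_mult_diff_rdistrib inner_add_right inner_diff_right)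
qed

text \<open>The equation for \<open>Pstar\<close> eliminates the drift \<open>A\<close>, and what
  remains factors through \<open>1 - m\<close>. The sign of this factor pushes the multiple back
  towards 1; \<open>s\<close> is the form of \<open>matrix_inv R\<close> at
  \<open>transpose B *v (Pstar *v x)\<close>.\<close>

lemma riccati_quadratic_form_contact:
  fixes A E Pstar :: "real^'n^'n" and B :: "real^'m^'n"
  assumes X: "transpose X = X" and Pstar: "transpose Pstar = Pstar"
    and eq: "riccati_rhs A B Q R Pstar = 0" and R: "sym_posdef R"
    and contact: "X *v x = m *\<^sub>R (Pstar *v x)"
  shows "\<exists>s\<ge>0. x \<bullet> (riccati_rhs (A + E) B Q R X *v x)
    = (1 - m) * (m * s + x \<bullet> (Q *v x)) + 2 * m * ((E *v x) \<bullet> (Pstar *v x))"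
proof -
  define y where "y = transpose B *v (Pstar *v x)"
  define s where "s = y \<bullet> (matrix_inv R *v y)"
  have "0 = x \<bullet> (riccati_rhs A B Q R Pstar *v x)" by (simp add: eq)
  then have 0: "2 * ((A *v x) \<bullet> (Pstar *v x)) = s - x \<bullet> (Q *v x)"
    unfolding riccati_quadratic_form[OF Pstar] s_def y_def by linarith
  have "transpose B *v (X *v x) = m *\<^sub>R y"
    by (simp only: contact y_def matrix_vector_mult_scaleR)
  then have "x \<bullet> (riccati_rhs (A + E) B Q R X *v x)
    = 2 * (((A + E) *v x) \<bullet> (m *\<^sub>R (Pstar *v x))) - (m *\<^sub>R y) \<bullet> (matrix_inv R *v (m *\<^sub>R y)) + x \<bullet> (Q *v x)"
    unfolding riccati_quadratic_form[OF X] by (simp only: contact)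
  also have "\<dots> = m * (2 * ((A *v x) \<bullet> (Pstar *v x))) + 2 * m * ((E *v x) \<bullet> (Pstar *v x)) - m^2 * s + x \<bullet> (Q *v x)"
    by (simp add: s_def matrix_vector_mult_add_rdistrib inner_add_left matrix_vector_mult_scaleR power2_eq_square algebra_simps)
  also have "\<dots> = (1 - m) * (m * s + x \<bullet> (Q *v x)) + 2 * m * ((E *v x) \<bullet> (Pstar *v x))"
    unfolding 0 by (simp add: power2_eq_square algebra_simps)
  finally show ?thesis using sym_posdef_matrix_inv(2)[OF R] s_def by blast
qed

text \<open>A deterministic statement, to be applied path by path. Once the noise is small, two
  barriers enclose \<open>P t\<close> between multiples of \<open>Pstar\<close> near 1; this gives
  the limits of all quadratic forms, and polarisation recovers the entries.\<close>

lemma riccati_convergence: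
  fixes A Q Pstar :: "real^'n^'n" and B :: "real^'m^'n" and E P :: "real \<Rightarrow> real^'n^'n"
  assumes Q: "sym_posdef Q" and R: "sym_posdef R" and Pstar: "sym_posdef Pstar"
    and eq: "riccati_rhs A B Q R Pstar = 0"
    and init: "sym_posdef (P 0)" and cont: "continuous_on {0..} P"
    and deriv: "\<And>t. 0 < t \<Longrightarrow> (P has_vector_derivative riccati_rhs (A + E t) B Q R (P t)) (at t)"
    and sym: "\<And>t. 0 \<le> t \<Longrightarrow> transpose (P t) = P t"
    and E: "(E \<longlongrightarrow> 0) at_top"
  shows "(P \<longlongrightarrow> Pstar) at_top"
proof -
  have Pt: "transpose Pstar = Pstar" using Pstar by (simp add: sym_posdef_def)
  \<comment> \<open>On the kernel of \<open>P t\<close> only the term of \<open>Q\<close> survives,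
    so zero is a lower barrier whatever the size of the noise.\<close>
  have posdef: "sym_posdef (P t)" if "0 \<le> t" for t
  proof (rule sym_posdef_barrier[OF cont sym init deriv])
    fix t and x :: "real^'n" assume "0 < t" "x \<noteq> 0" "P t *v x = 0"
    then show "0 < x \<bullet> (riccati_rhs (A + E t) B Q R (P t) *v x)"
      using Q by (subst riccati_quadratic_form) (auto simp: sym sym_posdef_def)
  qed (use that in auto)
  define p where "p x = x \<bullet> (Pstar *v x)" for x
  have p_pos: "0 < p x" if "x \<noteq> 0" for x using Pstar that by (simp add: p_def sym_posdef_def)
  have form: "x \<bullet> ((c *\<^sub>R Pstar - X) *v x) = c * p x - x \<bullet> (X *v x)"
    "x \<bullet> ((X - c *\<^sub>R Pstar) *v x) = x \<bullet> (X *v x) - c * p x" for c X x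
    by (simp_all add: p_def matrix_vector_mult_diff_rdistrib inner_diff_right scaleR_matrix_vector_assoc[symmetric])
  obtain p0 where p0: "0 < p0" "\<And>x. p0 * (x \<bullet> x) \<le> p x"
    using sym_posdef_lower_bound[OF Pstar] by (auto simp: p_def)
  obtain q0 where q0: "0 < q0" "\<And>x. q0 * (x \<bullet> x) \<le> x \<bullet> (Q *v x)"
    using sym_posdef_lower_bound[OF Q] by auto
  obtain k where k: "0 < k" "\<And>(X :: real^'n^'n) x. norm (X *v x) \<le> norm X * norm x * k"
    using bounded_bilinear.pos_bounded[OF bounded_bilinear_matrix_vector_mult[where 'n='n and 'm='n]] by auto
  have quad: "\<bar>x \<bullet> (X *v x)\<bar> \<le> k * norm X * (x \<bullet> x)" for X :: "real^'n^'n" and x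
  proof -
    have "\<bar>x \<bullet> (X *v x)\<bar> \<le> norm x * norm (X *v x)" by (rule Cauchy_Schwarz_ineq2)
    also have "\<dots> \<le> norm x * (norm X * norm x * k)" by (intro mult_left_mono k) auto
    also have "\<dots> = k * norm X * (x \<bullet> x)" by (simp add: norm_eq_sqrt_inner)
    finally show ?thesis .
  qed
  define \<kappa> where "\<kappa> = k^2 * norm Pstar / p0"
  have \<kappa>: "0 \<le> \<kappa>" using k p0 by (simp add: \<kappa>_def)
  have e_bound: "\<bar>(X *v x) \<bullet> (Pstar *v x)\<bar> \<le> \<kappa> * norm X * p x" for X :: "real^'n^'n" and x
  proof -
    have "\<bar>(X *v x) \<bullet> (Pstar *v x)\<bar> \<le> norm (X *v x) * norm (Pstar *v x)" by (rule Cauchy_Schwarz_ineq2)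
    also have "\<dots> \<le> (norm X * norm x * k) * (norm Pstar * norm x * k)"
      using k(1) by (intro mult_mono k) auto
    also have "\<dots> = k^2 * norm Pstar * norm X * (x \<bullet> x)"
      by (simp add: norm_eq_sqrt_inner power2_eq_square)
    also have "\<dots> = \<kappa> * norm X * (p0 * (x \<bullet> x))" using p0(1) by (simp add: \<kappa>_def)
    also have "\<dots> \<le> \<kappa> * norm X * p x" using \<kappa> by (intro mult_left_mono p0) auto
    finally show ?thesis .
  qed
  \<comment> \<open>\<open>\<rho>\<close> is chosen so that \<open>Q\<close> dominates
    \<open>\<rho> *\<^sub>R Pstar\<close>; it is the rate of the restoring term in both
    barriers.\<close>
  define \<rho> where "\<rho> = q0 / (k * norm Pstar + 1)"
  have d: "0 < k * norm Pstar + 1" using k(1) by (simp add: add_nonneg_pos)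
  have \<rho>: "0 < \<rho>" using q0(1) d by (simp add: \<rho>_def)
  have q_bound: "\<rho> * p x \<le> x \<bullet> (Q *v x)" for x
  proof -
    have "p x \<le> k * norm Pstar * (x \<bullet> x)" using quad[of x Pstar] by (simp add: p_def)
    also have "\<dots> \<le> (k * norm Pstar + 1) * (x \<bullet> x)" by (intro mult_right_mono) auto
    finally have "\<rho> * p x \<le> \<rho> * ((k * norm Pstar + 1) * (x \<bullet> x))"
      using \<rho> by (intro mult_left_mono) auto
    also have "\<dots> = q0 * (x \<bullet> x)" using d by (simp add: \<rho>_def)
    finally show ?thesis using q0(2)[of x] by linarith
  qed
  have squeeze: "\<forall>\<^sub>F t in at_top. \<forall>x. \<bar>x \<bullet> (P t *v x) - p x\<bar> \<le> 2 * \<delta> * p x"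
    if \<delta>: "0 < \<delta>" "\<delta> < 1" for \<delta>
  proof -
    \<comment> \<open>The noise contributes at most \<open>2 * m * \<eta>\<close>, that is
      \<open>m * \<rho> * \<delta> / 4\<close>, times \<open>p x\<close>. This is small enough for
      the restoring term in both barriers.\<close>
    define \<eta> where "\<eta> = \<rho> * \<delta> / 8"
    have \<eta>: "0 < \<eta>" using \<rho> \<delta> by (simp add: \<eta>_def)
    have "((\<lambda>t. \<kappa> * norm (E t)) \<longlongrightarrow> \<kappa> * norm (0 :: real^'n^'n)) at_top"
      by (intro tendsto_intros E)
    then have "\<forall>\<^sub>F t in at_top. \<kappa> * norm (E t) < \<eta>"
      using \<eta> by (intro order_tendstoD) auto
    then obtain T0 where T0: "\<And>t. T0 \<le> t \<Longrightarrow> \<kappa> * norm (E t) < \<eta>"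
      by (auto simp: eventually_at_top_linorder)
    define T where "T = max T0 1"
    have T: "0 < T" "0 \<le> T" by (auto simp: T_def)
    have e_small: "\<bar>(E t *v x) \<bullet> (Pstar *v x)\<bar> \<le> \<eta> * p x" if "T \<le> t" for t x
    proof -
      have "0 \<le> p x" using p_pos[of x] by (cases "x = 0") (auto simp: p_def)
      then have "\<kappa> * norm (E t) * p x \<le> \<eta> * p x"
        using T0[of t] that by (intro mult_right_mono) (auto simp: T_def)
      then show ?thesis using e_bound[where X="E t" and x=x] by linarith
    qed
    \<comment> \<open>The barriers relax at half the rate \<open>\<rho>\<close>, leaving part of the
      restoring term to absorb the noise.\<close>
    define u where "u t = exp (- (\<rho>/2) * (t - T))" for t
    have u_pos: "0 < u t" for t by (simp add: u_def)
    have u_le: "u t \<le> 1" if "T \<le> t" for t using that \<rho> by (simp add: u_def)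
    have u_deriv: "(u has_real_derivative - (\<rho>/2) * u t) (at t)" for t
      unfolding u_def by (auto intro!: derivative_eq_intros)
    have u_cont: "continuous_on S u" for S
      unfolding u_def by (intro continuous_intros)
    have contT: "continuous_on {T..} P" using T by (intro continuous_on_subset[OF cont]) auto

    \<comment> \<open>\<open>L *\<^sub>R Pstar\<close> dominates \<open>P T\<close>, so the upper
      barrier starts strictly above the solution.\<close>
    define L where "L = k * norm (P T) / p0"
    have L: "0 \<le> L" using k p0 by (simp add: L_def)
    define m where "m t = 1 + \<delta> + L * u t" for t
    have m_ge: "1 + \<delta> \<le> m t" for t using L u_pos[of t] by (simp add: m_def)
    have upper: "sym_posdef (m t *\<^sub>R Pstar - P t)" if "T \<le> t" for t
    proof (rule sym_posdef_barrier[where a=T and G="\<lambda>t. m t *\<^sub>R Pstar - P t"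
          and G'="\<lambda>t. (- (\<rho>/2) * L * u t) *\<^sub>R Pstar - riccati_rhs (A + E t) B Q R (P t)"])
      show "continuous_on {T..} (\<lambda>t. m t *\<^sub>R Pstar - P t)"
        unfolding m_def by (intro continuous_intros u_cont contT)
      show symG: "transpose (m t *\<^sub>R Pstar - P t) = m t *\<^sub>R Pstar - P t" if "T \<le> t" for t
        using sym[of t] Pt that T bounded_linear.linear[OF bounded_linear_transpose[where 'n='n and 'm='n]]
        by (simp add: linear_diff linear_cmul)
      show "sym_posdef (m T *\<^sub>R Pstar - P T)"
        unfolding sym_posdef_def
      proof (intro conjI allI impI symG order_refl)
        fix x :: "real^'n" assume x: "x \<noteq> 0"
        have "x \<bullet> (P T *v x) \<le> k * norm (P T) * (x \<bullet> x)" using quad[of x "P T"] by simp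
        also have "\<dots> = L * (p0 * (x \<bullet> x))" using p0 by (simp add: L_def)
        also have "\<dots> \<le> L * p x" by (intro mult_left_mono p0 L)
        also have "\<dots> < m T * p x" using p_pos[OF x] \<delta> by (intro mult_strict_right_mono) (auto simp: m_def u_def)
        finally show "0 < x \<bullet> ((m T *\<^sub>R Pstar - P T) *v x)"
          by (simp only: form diff_gt_0_iff_gt)
      qed
      show "((\<lambda>t. m t *\<^sub>R Pstar - P t) has_vector_derivative
          (- (\<rho>/2) * L * u t) *\<^sub>R Pstar - riccati_rhs (A + E t) B Q R (P t)) (at t)" if "T < t" for t
      proof -
        have "(m has_real_derivative - (\<rho>/2) * L * u t) (at t)"
          unfolding m_def by (auto intro!: derivative_eq_intros u_deriv)
        then show ?thesis
          using that T deriv[of t] by (auto intro!: derivative_eq_intros)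
      qed
      fix t and x :: "real^'n" assume t: "T < t" and x: "x \<noteq> 0" and "(m t *\<^sub>R Pstar - P t) *v x = 0"
      then have contact: "P t *v x = m t *\<^sub>R (Pstar *v x)"
        by (simp add: matrix_vector_mult_diff_rdistrib scaleR_matrix_vector_assoc)
      obtain s where s: "0 \<le> s" "x \<bullet> (riccati_rhs (A + E t) B Q R (P t) *v x)
          = (1 - m t) * (m t * s + x \<bullet> (Q *v x)) + 2 * m t * ((E t *v x) \<bullet> (Pstar *v x))"
        using riccati_quadratic_form_contact[OF _ Pt eq R contact] sym[of t] t T by auto
      have "(m t - 1) * (\<rho> * p x) \<le> (m t - 1) * (m t * s + x \<bullet> (Q *v x))"
        using m_ge[of t] \<delta> s(1) q_bound[of x] by (intro mult_left_mono add_increasing) auto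
      moreover have "2 * m t * ((E t *v x) \<bullet> (Pstar *v x)) \<le> 2 * m t * (\<eta> * p x)"
        using m_ge[of t] \<delta> e_small[of t x] t by (intro mult_left_mono) auto
      \<comment> \<open>The three terms are the motion of the barrier, the restoring term and the
        noise. The sum is positive because \<open>\<delta> < 1\<close>.\<close>
      moreover have "0 < p x * (- (\<rho>/2) * L * u t + (m t - 1) * \<rho> - 2 * m t * \<eta>)"
      proof (intro mult_pos_pos p_pos x)
        have "\<rho> * \<delta> * \<delta> < \<rho> * \<delta>" "0 \<le> \<rho> * (L * u t)" "0 < \<rho> * \<delta>"
          using \<rho> \<delta> L u_pos[of t] by auto
        moreover have "(\<rho> * (L * u t)) * \<delta> \<le> (\<rho> * (L * u t)) * 1"
          using \<rho> \<delta> L u_pos[of t] by (intro mult_left_mono) auto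
        ultimately show "0 < - (\<rho>/2) * L * u t + (m t - 1) * \<rho> - 2 * m t * \<eta>"
          by (simp add: m_def \<eta>_def algebra_simps)
      qed
      ultimately have "0 < (- (\<rho>/2) * L * u t) * p x - x \<bullet> (riccati_rhs (A + E t) B Q R (P t) *v x)"
        unfolding s(2) by (simp add: algebra_simps)
      then show "0 < x \<bullet> (((- (\<rho>/2) * L * u t) *\<^sub>R Pstar - riccati_rhs (A + E t) B Q R (P t)) *v x)"
        by (simp only: form diff_gt_0_iff_gt)
    qed (rule that)

    \<comment> \<open>The lower multiple starts at 0, where the definiteness of \<open>P T\<close>
      is the initial condition, and rises towards \<open>1 - \<delta>\<close>.\<close>
    define n where "n t = (1 - \<delta>) * (1 - u t)" for t
    have n: "0 \<le> n t" "n t \<le> 1" if "T \<le> t" for t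
      using \<delta> u_le[OF that] u_pos[of t] by (auto simp: n_def intro!: mult_le_one)
    have lower: "sym_posdef (P t - n t *\<^sub>R Pstar)" if "T \<le> t" for t
    proof (rule sym_posdef_barrier[where a=T and G="\<lambda>t. P t - n t *\<^sub>R Pstar"
          and G'="\<lambda>t. riccati_rhs (A + E t) B Q R (P t) - ((1 - \<delta>) * (\<rho>/2) * u t) *\<^sub>R Pstar"])
      show "continuous_on {T..} (\<lambda>t. P t - n t *\<^sub>R Pstar)"
        unfolding n_def by (intro continuous_intros u_cont contT)
      show "transpose (P t - n t *\<^sub>R Pstar) = P t - n t *\<^sub>R Pstar" if "T \<le> t" for t
        using sym[of t] Pt that T bounded_linear.linear[OF bounded_linear_transpose[where 'n='n and 'm='n]]
        by (simp add: linear_diff linear_cmul)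
      show "sym_posdef (P T - n T *\<^sub>R Pstar)"
        using posdef[of T] T by (simp add: n_def u_def)
      show "((\<lambda>t. P t - n t *\<^sub>R Pstar) has_vector_derivative
          riccati_rhs (A + E t) B Q R (P t) - ((1 - \<delta>) * (\<rho>/2) * u t) *\<^sub>R Pstar) (at t)" if "T < t" for t
      proof -
        have "(n has_real_derivative (1 - \<delta>) * (\<rho>/2) * u t) (at t)"
          unfolding n_def by (auto intro!: derivative_eq_intros u_deriv)
        then show ?thesis
          using that T deriv[of t] by (auto intro!: derivative_eq_intros)
      qed
      fix t and x :: "real^'n" assume t: "T < t" and x: "x \<noteq> 0" and "(P t - n t *\<^sub>R Pstar) *v x = 0"
      then have contact: "P t *v x = n t *\<^sub>R (Pstar *v x)"
        by (simp add: matrix_vector_mult_diff_rdistrib scaleR_matrix_vector_assoc)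
      obtain s where s: "0 \<le> s" "x \<bullet> (riccati_rhs (A + E t) B Q R (P t) *v x)
          = (1 - n t) * (n t * s + x \<bullet> (Q *v x)) + 2 * n t * ((E t *v x) \<bullet> (Pstar *v x))"
        using riccati_quadratic_form_contact[OF _ Pt eq R contact] sym[of t] t T by auto
      have "(1 - n t) * (\<rho> * p x) \<le> (1 - n t) * (n t * s + x \<bullet> (Q *v x))"
        using n[of t] t s(1) q_bound[of x] by (intro mult_left_mono add_increasing) auto
      moreover have "2 * n t * (- (\<eta> * p x)) \<le> 2 * n t * ((E t *v x) \<bullet> (Pstar *v x))"
        using n[of t] e_small[of t x] t by (intro mult_left_mono) auto
      moreover have "0 < p x * ((1 - n t) * \<rho> - 2 * n t * \<eta> - (1 - \<delta>) * (\<rho>/2) * u t)"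
      proof (intro mult_pos_pos p_pos x)
        have "n t * (\<rho> * \<delta>) \<le> 1 * (\<rho> * \<delta>)"
          using n[of t] t \<rho> \<delta> by (intro mult_right_mono) auto
        moreover have "0 < \<rho> * \<delta>" "0 < \<rho> * ((1 - \<delta>) * u t)" using \<rho> \<delta> u_pos[of t] by auto
        moreover have "(1 - n t) * \<rho> = \<rho> * \<delta> + \<rho> * ((1 - \<delta>) * u t)"
          by (simp add: n_def algebra_simps)
        moreover have "2 * n t * \<eta> = n t * (\<rho> * \<delta>) / 4"
          "(1 - \<delta>) * (\<rho>/2) * u t = \<rho> * ((1 - \<delta>) * u t) / 2"
          by (simp_all add: \<eta>_def)
        ultimately show "0 < (1 - n t) * \<rho> - 2 * n t * \<eta> - (1 - \<delta>) * (\<rho>/2) * u t"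
          by linarith
      qed
      ultimately have "0 < x \<bullet> (riccati_rhs (A + E t) B Q R (P t) *v x) - ((1 - \<delta>) * (\<rho>/2) * u t) * p x"
        unfolding s(2) by (simp add: algebra_simps)
      then show "0 < x \<bullet> ((riccati_rhs (A + E t) B Q R (P t) - ((1 - \<delta>) * (\<rho>/2) * u t) *\<^sub>R Pstar) *v x)"
        by (simp only: form diff_gt_0_iff_gt)
    qed (rule that)

    have "filterlim (\<lambda>t. - T + t) at_top at_top"
      by (intro filterlim_tendsto_add_at_top[OF tendsto_const] filterlim_ident)
    then have "filterlim (\<lambda>t. - (\<rho>/2) * (- T + t)) at_bot at_top"
      using \<rho> by (intro filterlim_tendsto_neg_mult_at_bot[OF tendsto_const]) auto
    then have "(u \<longlongrightarrow> 0) at_top"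
      unfolding u_def by (intro filterlim_compose[OF exp_at_bot]) simp
    \<comment> \<open>The factor \<open>L + 1\<close> makes one condition control both
      \<open>L * u t\<close> in \<open>m\<close> and \<open>u t\<close> in \<open>n\<close>.\<close>
    then have "((\<lambda>t. (L + 1) * u t) \<longlongrightarrow> (L + 1) * 0) at_top" by (intro tendsto_intros)
    then have "\<forall>\<^sub>F t in at_top. (L + 1) * u t < \<delta>"
      using \<delta> by (intro order_tendstoD) auto
    moreover have "\<forall>\<^sub>F t in at_top. T \<le> t" by (rule eventually_ge_at_top)
    ultimately show ?thesis
    proof eventually_elim
      case (elim t)
      have "0 \<le> L * u t" "0 < \<delta> * u t" using L \<delta> u_pos[of t] by simp_all
      then have mn: "m t \<le> 1 + 2 * \<delta>" "1 - 2 * \<delta> \<le> n t"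
        using elim(1) u_pos[of t]
        by (simp_all only: m_def n_def ring_distribs mult_1_left mult_1_right)
      show ?case
      proof
        fix x
        show "\<bar>x \<bullet> (P t *v x) - p x\<bar> \<le> 2 * \<delta> * p x"
        proof (cases "x = 0")
          case False
          have "x \<bullet> (P t *v x) < m t * p x" "n t * p x < x \<bullet> (P t *v x)"
            using upper[OF elim(2)] lower[OF elim(2)] False
            by (auto simp: sym_posdef_def form)
          moreover have "m t * p x \<le> (1 + 2 * \<delta>) * p x" "(1 - 2 * \<delta>) * p x \<le> n t * p x"
            using mn p_pos[OF False] by (auto intro!: mult_right_mono)
          ultimately show ?thesis by (simp add: abs_le_iff algebra_simps)
        qed (simp add: p_def)
      qed
    qed
  qed
  have quad_lim: "((\<lambda>t. x \<bullet> (P t *v x)) \<longlongrightarrow> p x) at_top" for x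
  proof (rule tendstoI)
    fix \<epsilon> :: real assume \<epsilon>: "0 < \<epsilon>"
    have px: "0 \<le> p x" using p_pos[of x] by (cases "x = 0") (auto simp: p_def)
    \<comment> \<open>The cap 1/2 meets the condition of \<open>squeeze\<close>, and the
      \<open>+ 1\<close> covers \<open>x = 0\<close>, where \<open>p x\<close> vanishes.\<close>
    define \<delta> where "\<delta> = min (1/2) (\<epsilon> / (4 * (p x + 1)))"
    have \<delta>: "0 < \<delta>" "\<delta> < 1" using \<epsilon> px by (auto simp: \<delta>_def)
    have "\<delta> * (4 * (p x + 1)) \<le> \<epsilon> / (4 * (p x + 1)) * (4 * (p x + 1))"
      using px by (intro mult_right_mono) (auto simp: \<delta>_def)
    also have "\<dots> = \<epsilon>" using px by simp
    finally have "4 * \<delta> * p x + 4 * \<delta> \<le> \<epsilon>" by (simp add: algebra_simps)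
    moreover have "0 \<le> \<delta> * p x" using \<delta> px by simp
    ultimately have "2 * \<delta> * p x < \<epsilon>" using \<delta> by linarith
    with squeeze[OF \<delta>] show "\<forall>\<^sub>F t in at_top. dist (x \<bullet> (P t *v x)) (p x) < \<epsilon>"
      by (auto simp: dist_real_def elim!: eventually_mono intro: le_less_trans)
  qed
  \<comment> \<open>A quadratic form determines its matrix only among symmetric ones, so the
    symmetry of \<open>P t\<close> is essential here.\<close>
  have polar: "X $ i $ j = (q (axis i 1 + axis j 1) - q (axis i 1) - q (axis j 1)) / 2"
    if "transpose X = X" and q: "\<And>x. q x = x \<bullet> (X *v x)" for X :: "real^'n^'n" and q i j
  proof -
    have e: "axis a 1 \<bullet> (X *v axis b 1) = X $ a $ b" for a b
      by (simp add: inner_axis' matrix_vector_mul_component inner_axis)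
    have "X $ j $ i = X $ i $ j" using that(1) by (metis transpose_def vec_lambda_beta)
    then show ?thesis
      by (simp add: q e matrix_vector_right_distrib inner_add_left inner_add_right)
  qed
  show ?thesis
  proof (intro vec_tendstoI)
    fix i j
    have "((\<lambda>t. ((axis i 1 + axis j 1) \<bullet> (P t *v (axis i 1 + axis j 1)) - axis i 1 \<bullet> (P t *v axis i 1)
        - axis j 1 \<bullet> (P t *v axis j 1)) / 2) \<longlongrightarrow> (p (axis i 1 + axis j 1) - p (axis i 1) - p (axis j 1)) / 2) at_top"
      by (intro tendsto_intros quad_lim) simp
    also have "(p (axis i 1 + axis j 1) - p (axis i 1) - p (axis j 1)) / 2 = Pstar $ i $ j"
      using polar[OF Pt p_def] by simp
    finally show "((\<lambda>t. P t $ i $ j) \<longlongrightarrow> Pstar $ i $ j) at_top"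
    proof (rule Lim_transform_eventually)
      show "\<forall>\<^sub>F t in at_top. ((axis i 1 + axis j 1) \<bullet> (P t *v (axis i 1 + axis j 1)) - axis i 1 \<bullet> (P t *v axis i 1)
        - axis j 1 \<bullet> (P t *v axis j 1)) / 2 = P t $ i $ j"
        using eventually_ge_at_top[of 0]
        by eventually_elim (rule polar[OF sym refl, symmetric])
    qed
  qed
qed

theorem mainTheorem9:
  fixes M :: "'a measure" and F :: "real \<Rightarrow> 'a measure"
    and w :: "'k::finite \<Rightarrow> real \<Rightarrow> 'a \<Rightarrow> real"
    and D :: "'k \<Rightarrow> real^'n^'n"
    and A Q Pstar :: "real^'n^'n" and B :: "real^'m^'n" and R :: "real^'m^'m"
    and P :: "real \<Rightarrow> 'a \<Rightarrow> real^'n^'n"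
  assumes "prob_space M" and "complete_measure M"
    and "filtration_of M F"
    and "\<And>i. standard_BM M (w i)"
    and "prob_space.indep_vars M (\<lambda>_. Pi\<^sub>M {0..} (\<lambda>_. borel))
           (\<lambda>i \<omega>. restrict (\<lambda>t. w i t \<omega>) {0..}) UNIV"
    and "\<And>i t. 0 \<le> t \<Longrightarrow> w i t \<in> borel_measurable (F t)"
    and "stabilizable A B"
    and "sym_posdef Q" and "sym_posdef R"
    and "sym_posdef Pstar" and "riccati_rhs A B Q R Pstar = 0"
    and "AE \<omega> in M. sym_posdef (P 0 \<omega>) \<and> continuous_on {0..} (\<lambda>t. P t \<omega>) \<and>
           (\<forall>t>0. ((\<lambda>s. P s \<omega>) has_vector_derivative
                     riccati_rhs (Abar A D w t \<omega>) B Q R (P t \<omega>)) (at t))"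
  shows "AE \<omega> in M. ((\<lambda>t. P t \<omega>) \<longlongrightarrow> Pstar) at_top"
proof -
  \<comment> \<open>The index type is finite, so the exceptional null sets can be merged and the
    rest is argued for a fixed path.\<close>
  have "AE \<omega> in M. \<forall>i. \<exists>C. \<forall>t>0. \<bar>w i t \<omega>\<bar> \<le> C * (t powr (1/4) + t powr (3/4))"
    using standard_BM_growth_bound[OF assms(4)] by (simp add: AE_all_countable)
  with assms(12) show ?thesis
  proof eventually_elim
    case (elim \<omega>)
    obtain C where C: "\<And>i t. 0 < t \<Longrightarrow> \<bar>w i t \<omega>\<bar> \<le> C i * (t powr (1/4) + t powr (3/4))"
      using elim(2) by metis
    define E where "E t = (1 / t) *\<^sub>R (\<Sum>i\<in>UNIV. w i t \<omega> *\<^sub>R D i)" for t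
    define c where "c = (\<Sum>i\<in>UNIV. C i * norm (D i))"
    \<comment> \<open>Division by \<open>t\<close> lowers both exponents by 1. Both lie strictly
      between -1 and 0, which gives integrability at 0 for \<open>riccati_symmetric\<close> and
      decay at infinity for \<open>riccati_convergence\<close>.\<close>
    have E_bound: "norm (E t) \<le> c * (t powr (-3/4) + t powr (-1/4))" if t: "0 < t" for t
    proof -
      have "norm (\<Sum>i\<in>UNIV. w i t \<omega> *\<^sub>R D i) \<le> (\<Sum>i\<in>UNIV. C i * (t powr (1/4) + t powr (3/4)) * norm (D i))"
        using C[OF t] by (intro sum_norm_le) (auto intro!: mult_right_mono)
      also have "\<dots> = c * (t powr (1/4) + t powr (3/4))"
        by (simp add: c_def sum_distrib_right mult_ac)
      finally have "norm (E t) \<le> 1 / t * (c * (t powr (1/4) + t powr (3/4)))"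
        using t unfolding E_def by (simp add: divide_right_mono)
      also have "\<dots> = c * (t powr (1/4) / t + t powr (3/4) / t)" by (simp add: distrib_left add_divide_distrib)
      also have "t powr (1/4) / t = t powr (-3/4)" using t powr_diff[of t "1/4" 1] by simp
      also have "t powr (3/4) / t = t powr (-1/4)" using t powr_diff[of t "3/4" 1] by simp
      finally show ?thesis .
    qed
    have E_lim: "(E \<longlongrightarrow> 0) at_top"
    proof (rule Lim_null_comparison)
      show "\<forall>\<^sub>F t in at_top. norm (E t) \<le> c * (t powr (-3/4) + t powr (-1/4))"
        using eventually_gt_at_top[of 0] by eventually_elim (rule E_bound)
      have "((\<lambda>t::real. c * (t powr (-3/4) + t powr (-1/4))) \<longlongrightarrow> c * (0 + 0)) at_top"
        by (intro tendsto_intros tendsto_neg_powr filterlim_ident) auto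
      then show "((\<lambda>t::real. c * (t powr (-3/4) + t powr (-1/4))) \<longlongrightarrow> 0) at_top" by simp
    qed
    have init: "sym_posdef (P 0 \<omega>)" and cont: "continuous_on {0..} (\<lambda>t. P t \<omega>)"
      and deriv: "\<And>t. 0 < t \<Longrightarrow> ((\<lambda>s. P s \<omega>) has_vector_derivative riccati_rhs (A + E t) B Q R (P t \<omega>)) (at t)"
      using elim(1) by (auto simp: Abar_def E_def)
    have "transpose (P 0 \<omega>) = P 0 \<omega>" using init by (simp add: sym_posdef_def)
    note sym = riccati_symmetric[of Q R "\<lambda>t. P t \<omega>", OF assms(8,9) this cont deriv E_bound]
    show ?case
      by (rule riccati_convergence[OF assms(8-11) init cont deriv sym E_lim])
  qed
qed

end
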